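(* Let $G=(V,E)$ be a $d$-regular digraph with a 1-factorization $F=\{F_i\mid 0\le i<d\}$. Suppose there is an increasing sequence of positive integers $(D_k)$ such that for every pair of vertices $(u,v)$ of $G$ there is a word $\omega(u,v)$ over $\{0,\dots,d-1\}$ with the following properties: (1) the length of $\omega(u,v)$ equals one of the $D_k$; (2) $v$ is a vertex on the walk $u\,\omega(u,v)$; (3) for each fixed $u$, the words $\omega(u,v)$, $v\in V$, are distinct. Let $S$ be the routing scheme consisting of all walks $u\,\omega(u,v)$. Then there exists a routing schedule for $S$ with no waiting and time $\tau\le\sum_k D_k\, d^{D_k-1}$.
   Context: A digraph $G=(V,E)$ (multiple edges allowed) is $d$-regular if every vertex has in-degree and out-degree $d$. A 1-factor is a spanning subgraph in which every vertex has in-degree and out-degree $1$; a 1-factorization $\{F_0,\dots,F_{d-1}\}$ is a partition of $E$ into $d$ 1-factors. For a vertex $u$ and a word $\omega=(c_0,\dots,c_{m-1})$ with $c_j\in\{0,\dots,d-1\}$, $u\omega$ denotes the walk of length $m$ in $G$ that starts at $u$ and at step $j$ traverses the unique out-edge in $F_{c_j}$ of the current vertex. A routing scheme is a collection of walks. A routing schedule of time $\tau$ assigns to every edge-occurrence of every walk a time in $\{1,\dots,\tau\}$ such that along each walk times are strictly increasing and no edge of $G$ is assigned the same time twice. It has no waiting if along each walk the assigned times are consecutive integers. *)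

theory Defs
  imports "HOL-Analysis.Infinite_Sum" "Graph_Theory.Digraph_Component" "Graph_Theory.Arc_Walk"
begin

definition regular_digraph :: "('a, 'b) pre_digraph \<Rightarrow> nat \<Rightarrow> bool" where
  "regular_digraph G d \<longleftrightarrow> (\<forall>v\<in>verts G. in_degree G v = d \<and> out_degree G v = d)"

definition one_factor :: "('a, 'b) pre_digraph \<Rightarrow> ('a, 'b) pre_digraph \<Rightarrow> bool" where
  "one_factor H G \<longleftrightarrow> spanning H G \<and> regular_digraph H 1"

definition one_factorization ::
  "('a, 'b) pre_digraph \<Rightarrow> nat \<Rightarrow> (nat \<Rightarrow> ('a, 'b) pre_digraph) \<Rightarrow> bool" where
  "one_factorization G d F \<longleftrightarrow>
     (\<forall>i<d. one_factor (F i) G) \<and>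
     disjoint_family_on (\<lambda>i. arcs (F i)) {..<d} \<and>
     (\<Union>i<d. arcs (F i)) = arcs G"

primrec word_walk ::
  "(nat \<Rightarrow> ('a, 'b) pre_digraph) \<Rightarrow> 'a \<Rightarrow> nat list \<Rightarrow> 'b awalk" where
  "word_walk F u [] = []"
| "word_walk F u (c # cs) =
     (let e = (THE e. e \<in> out_arcs (F c) u) in e # word_walk F (head (F c) e) cs)"

text \<open>
  A collection of walks is an indexed family, so that the same walk may occur several times.
  The edge-occurrences are the pairs of an index and a position in the walk with that index.
\<close>

definition routing_scheme :: "('a, 'b) pre_digraph \<Rightarrow> 'i set \<Rightarrow> ('i \<Rightarrow> 'b awalk) \<Rightarrow> bool" where
  "routing_scheme G I S \<longleftrightarrow> (\<forall>i\<in>I. \<exists>u v. pre_digraph.awalk G u (S i) v)"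

definition edge_occurrences :: "'i set \<Rightarrow> ('i \<Rightarrow> 'b awalk) \<Rightarrow> ('i \<times> nat) set" where
  "edge_occurrences I S = (SIGMA i:I. {..<length (S i)})"

definition routing_schedule ::
  "('a, 'b) pre_digraph \<Rightarrow> 'i set \<Rightarrow> ('i \<Rightarrow> 'b awalk) \<Rightarrow> nat \<Rightarrow> ('i \<Rightarrow> nat \<Rightarrow> nat) \<Rightarrow> bool" where
  "routing_schedule G I S \<tau> t \<longleftrightarrow>
     routing_scheme G I S \<and>
     (\<forall>(i, j) \<in> edge_occurrences I S. t i j \<in> {1..\<tau>}) \<and>
     (\<forall>i\<in>I. strict_mono_on {..<length (S i)} (t i)) \<and>
     (\<forall>(i, j) \<in> edge_occurrences I S. \<forall>(i', j') \<in> edge_occurrences I S.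
        S i ! j = S i' ! j' \<and> t i j = t i' j' \<longrightarrow> (i, j) = (i', j'))"

definition no_waiting :: "'i set \<Rightarrow> ('i \<Rightarrow> 'b awalk) \<Rightarrow> ('i \<Rightarrow> nat \<Rightarrow> nat) \<Rightarrow> bool" where
  "no_waiting I S t \<longleftrightarrow> (\<forall>i\<in>I. \<forall>j. Suc j < length (S i) \<longrightarrow> t i (Suc j) = Suc (t i j))"

lemma one_factor_THE_out_arc:
  assumes "one_factor H G" "u \<in> verts G"
  defines "e \<equiv> THE e. e \<in> out_arcs H u"
  shows "e \<in> arcs H" "e \<in> arcs G" "tail G e = u" "head H e = head G e" "head G e \<in> verts G"
proof -
  have sp: "subgraph H G" and vs: "verts H = verts G"
    and deg: "card (out_arcs H u) = 1"
    using assms(1,2) by (auto simp: one_factor_def spanning_def regular_digraph_def out_degree_def)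
  obtain x where "out_arcs H u = {x}"
    using deg by (auto simp: card_1_singleton_iff)
  then have "e \<in> out_arcs H u"
    by (simp add: e_def)
  then show "e \<in> arcs H" "e \<in> arcs G" "tail G e = u" "head H e = head G e" "head G e \<in> verts G"
    using sp vs by (auto simp: subgraph_def compatible_def wf_digraph_def)
qed

lemma length_word_walk [simp]: "length (word_walk F u w) = length w"
  by (induction w arbitrary: u) (simp_all add: Let_def)

lemma awalk_word_walk:
  assumes "wf_digraph G" "one_factorization G d F" "u \<in> verts G" "set w \<subseteq> {..<d}"
  shows "\<exists>v. pre_digraph.awalk G u (word_walk F u w) v"
  using assms(3,4)
proof (induction w arbitrary: u)
  case Nil
  then show ?case
    by (auto simp: pre_digraph.awalk_def pre_digraph.cas.simps)
next
  case (Cons c cs)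
  have "one_factor (F c) G"
    using assms(2) Cons.prems by (auto simp: one_factorization_def)
  note e = one_factor_THE_out_arc[OF this Cons.prems(1)]
  show ?case
    using Cons.IH[OF e(5)] Cons.prems e
    by (auto simp: pre_digraph.awalk_def pre_digraph.cas.simps Let_def)
qed

end

theory Submission
  imports Defs
begin

text \<open>
  Walks with a common word never collide when they run synchronously, because each colour class
  acts on the vertices as a permutation. Two distinct words that differ by a constant modulo
  \<open>d\<close> have different letters at every position, so the \<open>d\<close> translates of a
  word can also run synchronously. The words of length \<open>n\<close> fall into
  \<open>d ^ (n - 1)\<close> such classes, each represented by a word that starts with 0, and it
  suffices to give every class its own block of \<open>n\<close> consecutive time steps.
\<close>

text \<open>The translate that starts with 0, used as the name of the class of \<open>w\<close>.
  Adding \<open>d - hd w\<close> avoids truncated subtraction. On \<open>[]\<close> the unspecified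
  \<open>hd\<close> does no harm, as nothing is mapped.\<close>

definition normal_word :: "nat \<Rightarrow> nat list \<Rightarrow> nat list" where
  "normal_word d w = map (\<lambda>c. (c + (d - hd w)) mod d) w"

lemma length_normal_word [simp]: "length (normal_word d w) = length w"
  by (simp add: normal_word_def)

text \<open>The congruence says that c - c' and a - b agree modulo \<open>d\<close>; all four
  numbers lie below \<open>d\<close>, so one difference vanishes iff the other does.\<close>

lemma normal_word_translate_eq:
  fixes a b c c' d :: nat
  assumes "a < d" "b < d" "c < d" "c' < d"
    and "(c + (d - a)) mod d = (c' + (d - b)) mod d"
  shows "c = c' \<longleftrightarrow> a = b"
proof -
  \<comment> \<open>The sum stays below 2d, so reducing it subtracts \<open>d\<close> at most
    once.\<close>
  have mod_eq: "(x + (d - y)) mod d = (if y \<le> x then x - y else x + d - y)"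
    if "x < d" "y < d" for x y
    using that by (auto simp: le_mod_geq)
  show ?thesis
    using assms(5) unfolding mod_eq[OF assms(3,1)] mod_eq[OF assms(4,2)]
    using assms(1-4) by (auto split: if_splits)
qed

text \<open>A single shared letter pins down the translation, and the translation pins down all
  letters. Hence distinct words of one class differ at every position.\<close>

lemma normal_word_inj:
  assumes "set w \<subseteq> {..<d}" "set w' \<subseteq> {..<d}"
    and eq: "normal_word d w = normal_word d w'"
    and j: "j < length w" "w ! j = w' ! j"
  shows "w = w'"
proof (rule nth_equalityI)
  show len: "length w = length w'"
    using eq length_normal_word by metis
  have bound: "w ! i < d" "w' ! i < d" if "i < length w" for i
    using subsetD[OF assms(1) nth_mem[of i w]] subsetD[OF assms(2) nth_mem[of i w']] that len
    by simp_all
  have "w \<noteq> []" "w' \<noteq> []"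
    using j(1) len by auto
  then have hd: "hd w < d" "hd w' < d"
    using subsetD[OF assms(1) hd_in_set] subsetD[OF assms(2) hd_in_set] by simp_all
  have letter: "(w ! i + (d - hd w)) mod d = (w' ! i + (d - hd w')) mod d" if "i < length w" for i
    using arg_cong[OF eq, of "\<lambda>xs. xs ! i"] that len by (simp add: normal_word_def)
  have "hd w = hd w'"
    using normal_word_translate_eq[OF hd bound[OF j(1)] letter[OF j(1)]] j(2) by simp
  then show "w ! i = w' ! i" if "i < length w" for i
    using normal_word_translate_eq[OF hd bound[OF that] letter[OF that]] by simp
qed

lemma normal_word_mem:
  assumes "set w \<subseteq> {..<d}" "w \<noteq> []"
  shows "normal_word d w \<in> (#) 0 ` {xs. set xs \<subseteq> {..<d} \<and> length xs = length w - 1}"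
  using assms by (cases w) (auto simp: normal_word_def intro!: imageI)

text \<open>Lay the blocks end to end: each new one begins at the total length of those placed
  before.\<close>

lemma exists_disjoint_blocks:
  fixes len :: "'c \<Rightarrow> nat"
  assumes "finite A"
  shows "\<exists>start. (\<forall>a\<in>A. start a + len a \<le> sum len A) \<and>
    (\<forall>a\<in>A. \<forall>b\<in>A. a \<noteq> b \<longrightarrow> {start a..<start a + len a} \<inter> {start b..<start b + len b} = {})"
  using assms
proof (induction A)
  case empty
  then show ?case by simp
next
  case (insert x A)
  then obtain start where bound: "\<forall>a\<in>A. start a + len a \<le> sum len A"
    and disj: "\<forall>a\<in>A. \<forall>b\<in>A. a \<noteq> b \<longrightarrow>
      {start a..<start a + len a} \<inter> {start b..<start b + len b} = {}"
    by blast
  define start' where "start' = start(x := sum len A)"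
  have old: "start' a = start a" "start a + len a \<le> sum len A" if "a \<in> A" for a
    using that insert.hyps bound by (auto simp: start'_def)
  have new: "start' x = sum len A"
    by (simp add: start'_def)
  have "\<forall>a\<in>insert x A. start' a + len a \<le> sum len (insert x A)"
    using insert.hyps old new by fastforce
  moreover have "\<forall>a\<in>insert x A. \<forall>b\<in>insert x A. a \<noteq> b \<longrightarrow>
      {start' a..<start' a + len a} \<inter> {start' b..<start' b + len b} = {}"
  proof (intro ballI impI)
    fix a b assume "a \<in> insert x A" "b \<in> insert x A" "a \<noteq> b"
    then consider "a = x" "b \<in> A" | "a \<in> A" "b = x" | "a \<in> A" "b \<in> A"
      by auto
    then show "{start' a..<start' a + len a} \<inter> {start' b..<start' b + len b} = {}"
    proof cases
      case 1
      then show ?thesis using old[of b] new by auto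
    next
      case 2
      then show ?thesis using old[of a] new by auto
    next
      case 3
      then show ?thesis using disj \<open>a \<noteq> b\<close> old(1) by simp
    qed
  qed
  ultimately show ?case by blast
qed

text \<open>This is the in-degree half of being a 1-factor; it allows a step to be undone once its
  colour is known.\<close>

lemma one_factor_head_inj:
  assumes "wf_digraph G" "one_factor H G" "e \<in> arcs H" "e' \<in> arcs H" "head G e = head G e'"
  shows "e = e'"
proof -
  have sp: "subgraph H G" and vs: "verts H = verts G"
    and deg: "\<forall>v\<in>verts H. card (in_arcs H v) = 1"
    using assms(2) by (auto simp: one_factor_def spanning_def regular_digraph_def in_degree_def)
  have "e \<in> in_arcs H (head G e)" "e' \<in> in_arcs H (head G e)" "head G e \<in> verts H"
    using sp vs assms by (auto simp: subgraph_def compatible_def wf_digraph_def)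
  then show ?thesis
    using deg by (metis card_1_singletonE singletonD)
qed

text \<open>Since the factors are disjoint, this lets an edge reveal the letter that was read when
  it was traversed.\<close>

lemma word_walk_nth_mem:
  assumes "wf_digraph G" "one_factorization G d F" "u \<in> verts G" "set w \<subseteq> {..<d}"
    and "j < length w"
  shows "word_walk F u w ! j \<in> arcs (F (w ! j))"
  using assms(3-5)
proof (induction w arbitrary: u j)
  case Nil
  then show ?case by simp
next
  case (Cons c cs)
  have "one_factor (F c) G"
    using assms(2) Cons.prems by (auto simp: one_factorization_def)
  note e = one_factor_THE_out_arc[OF this Cons.prems(1)]
  show ?case
    using Cons.IH[OF e(5)] Cons.prems e by (cases j) (auto simp: Let_def)
qed

text \<open>Each colour permutes the vertices, so a walk with known word can be traced back from any
  of its edges to its start.\<close>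

lemma word_walk_nth_inj:
  assumes "wf_digraph G" "one_factorization G d F" "u \<in> verts G" "u' \<in> verts G"
    and "set w \<subseteq> {..<d}" "j < length w" "word_walk F u w ! j = word_walk F u' w ! j"
  shows "u = u'"
  using assms(3-7)
proof (induction w arbitrary: u u' j)
  case Nil
  then show ?case by simp
next
  case (Cons c cs)
  have factor: "one_factor (F c) G"
    using assms(2) Cons.prems by (auto simp: one_factorization_def)
  define out where "out x = (THE e. e \<in> out_arcs (F c) x)" for x
  note e = one_factor_THE_out_arc[OF factor Cons.prems(1), folded out_def]
  note e' = one_factor_THE_out_arc[OF factor Cons.prems(2), folded out_def]
  have walk: "word_walk F x (c # cs) = out x # word_walk F (head (F c) (out x)) cs" for x
    by (simp only: word_walk.simps Let_def out_def)
  have "out u = out u'"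
  proof (cases j)
    case 0
    then show ?thesis
      using Cons.prems(5) unfolding walk by simp
  next
    case (Suc i)
    \<comment> \<open>The induction hypothesis identifies the second vertices; undoing the first
      step then identifies the first edges.\<close>
    then have "head G (out u) = head G (out u')"
      using Cons.IH[OF e(5) e'(5), of i] Cons.prems(3-5) e(4) e'(4) unfolding walk by simp
    then show ?thesis
      using one_factor_head_inj[OF assms(1) factor] e(1) e'(1) by blast
  qed
  then show ?case
    using e(3) e'(3) by metis
qed

text \<open>For positive n, prefixing 0 to a free tail of length n - 1 gives words of length exactly
  n, so different n contribute disjoint sets.\<close>

lemma sum_length_normal_words:
  fixes d :: nat
  assumes "finite L" "\<And>n. n \<in> L \<Longrightarrow> n > 0"
  defines "A \<equiv> (\<Union>n\<in>L. (#) 0 ` {xs. set xs \<subseteq> {..<d} \<and> length xs = n - 1})"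
  shows "finite A" "sum length A = (\<Sum>n\<in>L. n * d ^ (n - 1))"
proof -
  let ?B = "\<lambda>n. (#) 0 ` {xs. set xs \<subseteq> {..<d} \<and> length xs = n - 1}"
  have fin: "finite (?B n)" for n
    by (simp add: finite_lists_length_eq)
  then show "finite A"
    using assms(1) by (simp add: A_def)
  have length_B: "length w = n" if "n \<in> L" "w \<in> ?B n" for n w
    using that assms(2)[of n] by auto
  have "sum length A = (\<Sum>n\<in>L. sum length (?B n))"
    unfolding A_def
  proof (rule sum.UNION_disjoint)
    show "\<forall>i\<in>L. \<forall>j\<in>L. i \<noteq> j \<longrightarrow> ?B i \<inter> ?B j = {}"
      using length_B by blast
  qed (use assms(1) fin in auto)
  also have "\<dots> = (\<Sum>n\<in>L. n * d ^ (n - 1))"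
  proof (rule sum.cong[OF refl])
    fix n assume "n \<in> L"
    then have "sum length (?B n) = (\<Sum>w\<in>?B n. n)"
      using length_B by (intro sum.cong refl) blast
    also have "\<dots> = n * card (?B n)"
      by simp
    also have "card (?B n) = d ^ (n - 1)"
      by (subst card_image) (simp_all add: card_lists_length_eq)
    finally show "sum length (?B n) = n * d ^ (n - 1)" .
  qed
  finally show "sum length A = (\<Sum>n\<in>L. n * d ^ (n - 1))" .
qed

theorem theorem1:
  fixes G :: "('a, 'b) pre_digraph"
    and d :: nat
    and F :: "nat \<Rightarrow> ('a, 'b) pre_digraph"
    and K :: "nat set"
    and D :: "nat \<Rightarrow> nat"
    and \<omega> :: "'a \<Rightarrow> 'a \<Rightarrow> nat list"
  assumes "fin_digraph G"
    and "regular_digraph G d"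
    and "one_factorization G d F"
    and "strict_mono_on K D"
    and "\<And>k. k \<in> K \<Longrightarrow> D k > 0"
    and "\<And>u v. u \<in> verts G \<Longrightarrow> v \<in> verts G \<Longrightarrow> set (\<omega> u v) \<subseteq> {..<d}"
    and "\<And>u v. u \<in> verts G \<Longrightarrow> v \<in> verts G \<Longrightarrow> \<exists>k\<in>K. length (\<omega> u v) = D k"
    and "\<And>u v. u \<in> verts G \<Longrightarrow> v \<in> verts G \<Longrightarrow>
           v \<in> set (pre_digraph.awalk_verts G u (word_walk F u (\<omega> u v)))"
    and "\<And>u. u \<in> verts G \<Longrightarrow> inj_on (\<omega> u) (verts G)"
  shows "\<exists>\<tau> t.
      routing_schedule G (verts G \<times> verts G) (\<lambda>(u, v). word_walk F u (\<omega> u v)) \<tau> t \<and>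
      no_waiting (verts G \<times> verts G) (\<lambda>(u, v). word_walk F u (\<omega> u v)) t \<and>
      enat \<tau> \<le> (\<Sum>\<^sub>\<infinity>k\<in>K. enat (D k * d ^ (D k - 1)))"
proof -
  interpret fin_digraph G by fact
  let ?I = "verts G \<times> verts G"
  let ?S = "\<lambda>(u, v). word_walk F u (\<omega> u v)"
  have wf: "wf_digraph G" ..
  \<comment> \<open>Only lengths that occur are given blocks: \<open>K\<close> may be infinite, but
    \<open>L\<close> is finite.\<close>
  define L where "L = (\<lambda>(u, v). length (\<omega> u v)) ` ?I"
  define A where "A = (\<Union>n\<in>L. (#) 0 ` {xs. set xs \<subseteq> {..<d} \<and> length xs = n - 1})"
  have "finite L"
    by (simp add: L_def)
  have "L \<subseteq> D ` K"
    using assms(7) by (force simp: L_def)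
  then have L_pos: "n > 0" if "n \<in> L" for n
    using assms(5) that by auto
  have A: "finite A" "sum length A = (\<Sum>n\<in>L. n * d ^ (n - 1))"
    unfolding A_def using sum_length_normal_words[of L d] \<open>finite L\<close> L_pos by blast+
  obtain start where bound: "\<And>a. a \<in> A \<Longrightarrow> start a + length a \<le> sum length A"
    and disj: "\<And>a b. a \<in> A \<Longrightarrow> b \<in> A \<Longrightarrow> a \<noteq> b \<Longrightarrow>
      {start a..<start a + length a} \<inter> {start b..<start b + length b} = {}"
    using exists_disjoint_blocks[OF A(1), of length] by blast
  \<comment> \<open>All walks of a class start together at the beginning of its block and move at
    every step. Blocks count from 0 and times from 1, hence \<open>Suc\<close>.\<close>
  define t where "t = (\<lambda>(u, v) j. Suc (start (normal_word d (\<omega> u v)) + j))"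
  have in_A: "normal_word d (\<omega> u v) \<in> A" if "u \<in> verts G" "v \<in> verts G" for u v
  proof -
    have "length (\<omega> u v) \<in> L"
      using that by (force simp: L_def)
    moreover from this have "\<omega> u v \<noteq> []"
      using L_pos by fastforce
    ultimately show ?thesis
      using normal_word_mem[OF assms(6)[OF that]] unfolding A_def by blast
  qed
  have time: "t (u, v) j \<in> {1..sum length A}"
    if "u \<in> verts G" "v \<in> verts G" "j < length (\<omega> u v)" for u v j
    using bound[OF in_A[OF that(1,2)]] that(3) by (simp add: t_def)
  have conflict: "u = u' \<and> v = v' \<and> j = j'"
    if uv: "u \<in> verts G" "v \<in> verts G" "j < length (\<omega> u v)"
      and uv': "u' \<in> verts G" "v' \<in> verts G" "j' < length (\<omega> u' v')"
      and edge: "word_walk F u (\<omega> u v) ! j = word_walk F u' (\<omega> u' v') ! j'"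
      and same_time: "t (u, v) j = t (u', v') j'" for u v j u' v' j'
  proof -
    let ?a = "normal_word d (\<omega> u v)" and ?b = "normal_word d (\<omega> u' v')"
    \<comment> \<open>Equal times put both occurrences in one block, hence in one class and at the
      same position. The shared edge then gives a shared letter there, so the words
      coincide.\<close>
    have "start ?a + j \<in> {start ?a..<start ?a + length ?a} \<inter> {start ?b..<start ?b + length ?b}"
      using same_time uv(3) uv'(3) by (simp add: t_def)
    then have eq: "?a = ?b"
      using disj[OF in_A[OF uv(1,2)] in_A[OF uv'(1,2)]] by blast
    then have j: "j = j'"
      using same_time by (simp add: t_def)
    have "word_walk F u (\<omega> u v) ! j \<in> arcs (F (\<omega> u v ! j)) \<inter> arcs (F (\<omega> u' v' ! j))"
      using word_walk_nth_mem[OF wf assms(3) uv(1) assms(6)[OF uv(1,2)] uv(3)]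
        word_walk_nth_mem[OF wf assms(3) uv'(1) assms(6)[OF uv'(1,2)] uv'(3)] edge j by simp
    moreover have "\<omega> u v ! j < d" "\<omega> u' v' ! j < d"
      using assms(6)[OF uv(1,2)] assms(6)[OF uv'(1,2)] nth_mem[OF uv(3)] nth_mem[OF uv'(3)] j
      by auto
    ultimately have "\<omega> u v ! j = \<omega> u' v' ! j"
      using assms(3) by (auto simp: one_factorization_def disjoint_family_on_def)
    then have word: "\<omega> u v = \<omega> u' v'"
      using normal_word_inj[OF assms(6)[OF uv(1,2)] assms(6)[OF uv'(1,2)] eq uv(3)] by blast
    then have "u = u'"
      using word_walk_nth_inj[OF wf assms(3) uv(1) uv'(1) assms(6)[OF uv(1,2)] uv(3)] edge j by simp
    \<comment> \<open>From a fixed start, distinct targets have distinct words.\<close>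
    then show ?thesis
      using word j assms(9)[OF uv(1)] uv(2) uv'(2) by (auto dest: inj_onD)
  qed
  have "routing_scheme G ?I ?S"
    unfolding routing_scheme_def using awalk_word_walk[OF wf assms(3) _ assms(6)] by fast
  then have "routing_schedule G ?I ?S (sum length A) t"
    unfolding routing_schedule_def edge_occurrences_def
    using time conflict by (auto simp: strict_mono_on_def t_def)
  moreover have "no_waiting ?I ?S t"
    by (auto simp: no_waiting_def t_def)
  moreover have "enat (sum length A) \<le> (\<Sum>\<^sub>\<infinity>k\<in>K. enat (D k * d ^ (D k - 1)))"
  proof -
    have inj: "inj_on D K"
      using assms(4) by (rule strict_mono_on_imp_inj_on)
    \<comment> \<open>\<open>D\<close> maps these indices bijectively onto \<open>L\<close>, turning
      the finite sum over lengths into part of the series. In \<open>enat\<close> that series always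
      has a value, possibly infinite, and dropping terms cannot increase it.\<close>
    define K' where "K' = {k \<in> K. D k \<in> L}"
    have K': "K' \<subseteq> K" "D ` K' = L" "inj_on D K'"
      using \<open>L \<subseteq> D ` K\<close> inj by (auto simp: K'_def inj_on_def)
    then have "finite K'"
      using \<open>finite L\<close> finite_imageD by metis
    have "enat (sum length A) = enat (\<Sum>k\<in>K'. D k * d ^ (D k - 1))"
      unfolding A(2) K'(2)[symmetric] sum.reindex[OF K'(3)] by simp
    also have "\<dots> = (\<Sum>k\<in>K'. enat (D k * d ^ (D k - 1)))"
      using of_nat_sum[where 'a = enat] by (simp add: of_nat_eq_enat)
    also have "\<dots> = (\<Sum>\<^sub>\<infinity>k\<in>K'. enat (D k * d ^ (D k - 1)))"
      using \<open>finite K'\<close> by simp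
    also have "\<dots> \<le> (\<Sum>\<^sub>\<infinity>k\<in>K. enat (D k * d ^ (D k - 1)))"
      using K'(1) by (intro infsum_mono_neutral) (auto intro!: nonneg_summable_on_complete)
    finally show ?thesis .
  qed
  ultimately show ?thesis by blast
qed

end
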